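(* Let $X$ be a locally compact Hausdorff space with Borel $\sigma$-algebra $\Omega$, $E$ a Banach lattice, and $\pi\colon C_0(X)\to\mathcal L_{\mathrm r}(E)$ a positive representation. Suppose $\pi$ has a generating positive spectral measure $P$ on $\Omega$, and let $\pi_P\colon\mathcal B(X)\to\mathcal L_{\mathrm r}(E)$ denote the generated bounded positive representation of $\mathcal B(X)$ on $E$ extending $\pi$. Then: (1) $\pi\colon C_0(X)\to(\mathcal L_{\mathrm r}(E),\|\cdot\|)$ is bounded, and $\|\pi\|\leq\|\pi_P\|=\|P(X)\|$. (2) If $P$ is regular, then $\|\pi\|=\|\pi_P\|=\|P(X)\|$. (3) If $P$ is regular and $E$ is Dedekind complete, then the maps $\pi\colon C_0(X)\to(\mathcal L_{\mathrm r}(E),\|\cdot\|)$, $\pi\colon C_0(X)\to(\mathcal L_{\mathrm r}(E),\|\cdot\|_{\mathrm r})$, $\pi_P\colon\mathcal B(X)\to(\mathcal L_{\mathrm r}(E),\|\cdot\|)$, and $\pi_P\colon\mathcal B(X)\to(\mathcal L_{\mathrm r}(E),\|\cdot\|_{\mathrm r})$ are all bounded, and $\|\pi\|=\|\pi\|_{\mathrm r}=\|\pi_P\|=\|\pi_P\|_{\mathrm r}=\|P(X)\|$.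
   Context: All vector spaces are real. $C_0(X)$ is the Banach lattice algebra of real-valued continuous functions on $X$ vanishing at infinity, and $\mathcal B(X)$ that of bounded Borel measurable real-valued functions on $X$ (supremum norm, pointwise operations). $\mathcal L(E)$ denotes the bounded linear operators on $E$ with operator norm $\|\cdot\|$, and $\mathcal L_{\mathrm r}(E)\subset\mathcal L(E)$ the regular operators (differences of two positive linear operators). If $E$ is Dedekind complete, $\|T\|_{\mathrm r}=\||T|\|$ is the regular norm on $\mathcal L_{\mathrm r}(E)$. For a linear map into $\mathcal L_{\mathrm r}(E)$, $\|\cdot\|$ and $\|\cdot\|_{\mathrm r}$ of that map denote its norm when the codomain carries the operator norm, resp. the regular norm. A positive representation of an ordered algebra $A$ on $E$ is an algebra homomorphism $\pi\colon A\to\mathcal L(E)$ with $\pi(a)$ a positive operator for every $a\geq0$; it is not assumed bounded or unital. A positive spectral measure on $\Omega$ is a map $P\colon\Omega\to\mathcal L_{\mathrm r}(E)$ such that: each $P(\Delta)$ is a positive projection; $P(\emptyset)=0$; $P(\Delta_1\cap\Delta_2)=P(\Delta_1)P(\Delta_2)$ for all $\Delta_1,\Delta_2\in\Omega$; and for pairwise disjoint $\Delta_n\in\Omega$ ($n\geq1$) and $x\in E$ one has $P(\bigcup_n\Delta_n)x=\sum_nP(\Delta_n)x$ with norm convergence. For $x\in E$ and $x'$ in the norm dual $E'$, put $\mu_{x,x'}(\Delta)=\langle P(\Delta)x,x'\rangle$. $P$ is regular if every $\mu_{x,x'}$ is a regular finite signed Borel measure, i.e. a difference of two finite positive measures on $\Omega$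 that are outer regular (by open sets) on all Borel sets and inner regular (by compact sets) on all open sets. The representation generated by $P$ is the unique bounded linear map $\pi_P\colon\mathcal B(X)\to(\mathcal L(E),\|\cdot\|)$ with $\pi_P(\chi_\Delta)=P(\Delta)$ for all $\Delta\in\Omega$; it is a positive representation with values in $\mathcal L_{\mathrm r}(E)$, and $\langle\pi_P(\phi)x,x'\rangle=\int_X\phi\,d\mu_{x,x'}$. $P$ generates $\pi\colon C_0(X)\to\mathcal L_{\mathrm r}(E)$ if $\pi$ is the restriction of $\pi_P$ to $C_0(X)$. *)

theory Defs
  imports "HOL-Analysis.Analysis" "HOL-Library.Lattice_Algebras"
begin

class banach_lattice = banach + ordered_real_vector + lattice_ab_group_add_abs +
  assumes norm_mono_abs: "\<bar>x\<bar> \<le> \<bar>y\<bar> \<Longrightarrow> norm x \<le> norm y"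

definition dedekind_complete :: "'e::banach_lattice itself \<Rightarrow> bool" where
  "dedekind_complete _ \<longleftrightarrow>
    (\<forall>A::'e set. A \<noteq> {} \<longrightarrow> bdd_above A \<longrightarrow>
      (\<exists>s. (\<forall>a\<in>A. a \<le> s) \<and> (\<forall>u. (\<forall>a\<in>A. a \<le> u) \<longrightarrow> s \<le> u)))"


definition positive_map :: "('e::banach_lattice \<Rightarrow> 'e) \<Rightarrow> bool" where
  "positive_map T \<longleftrightarrow> (\<forall>x\<ge>0. 0 \<le> T x)"

definition regular_operators :: "('e::banach_lattice \<Rightarrow>\<^sub>L 'e) set" where
  "regular_operators =
    {T. \<exists>R S. linear R \<and> linear S \<and> positive_map R \<and> positive_map S \<and>
         blinfun_apply T = (\<lambda>x. R x - S x)}"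

definition op_le :: "('e::banach_lattice \<Rightarrow>\<^sub>L 'e) \<Rightarrow> ('e \<Rightarrow>\<^sub>L 'e) \<Rightarrow> bool" where
  "op_le S T \<longleftrightarrow> positive_map (blinfun_apply (T - S))"

text \<open>The modulus \<open>|T|\<close> is the supremum of \<open>T\<close> and \<open>-T\<close> in the ordered vector space of regular
  operators. It exists for every regular operator if the Banach lattice is Dedekind complete;
  \<open>op_modulus\<close> and \<open>regular_norm\<close> are meaningful only in that case.\<close>

definition is_op_modulus :: "('e::banach_lattice \<Rightarrow>\<^sub>L 'e) \<Rightarrow> ('e \<Rightarrow>\<^sub>L 'e) \<Rightarrow> bool" where
  "is_op_modulus T M \<longleftrightarrow>
    M \<in> regular_operators \<and> op_le T M \<and> op_le (- T) M \<and>
    (\<forall>U\<in>regular_operators. op_le T U \<longrightarrow> op_le (- T) U \<longrightarrow> op_le M U)"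

definition op_modulus :: "('e::banach_lattice \<Rightarrow>\<^sub>L 'e) \<Rightarrow> 'e \<Rightarrow>\<^sub>L 'e" where
  "op_modulus T = (THE M. is_op_modulus T M)"

definition regular_norm :: "('e::banach_lattice \<Rightarrow>\<^sub>L 'e) \<Rightarrow> real" where
  "regular_norm T = norm (op_modulus T)"


text \<open>A real-valued function on the space \<open>X\<close> is represented by the function on the whole type
  that agrees with it on \<open>topspace X\<close> and is zero elsewhere. Pointwise operations preserve this
  convention, and suprema of absolute values over \<open>topspace X\<close> may be taken over the whole type
  (which also gives the right value \<open>0\<close> if \<open>topspace X\<close> is empty).\<close>

definition borel_of :: "'x topology \<Rightarrow> 'x measure" where
  "borel_of X = sigma (topspace X) {U. openin X U}"

definition C0 :: "'x topology \<Rightarrow> ('x \<Rightarrow> real) set" where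
  "C0 X = {f. continuous_map X euclideanreal f \<and>
              (\<forall>e>0. \<exists>K. compactin X K \<and> (\<forall>t\<in>topspace X - K. \<bar>f t\<bar> < e)) \<and>
              (\<forall>t. t \<notin> topspace X \<longrightarrow> f t = 0)}"

definition bounded_borel :: "'x topology \<Rightarrow> ('x \<Rightarrow> real) set" where
  "bounded_borel X = {f. f \<in> borel_measurable (borel_of X) \<and> bounded (range f) \<and>
                         (\<forall>t. t \<notin> topspace X \<longrightarrow> f t = 0)}"

definition sup_norm :: "('x \<Rightarrow> real) \<Rightarrow> real" where
  "sup_norm f = (SUP t. \<bar>f t\<bar>)"


definition linear_on_funs :: "('x \<Rightarrow> real) set \<Rightarrow> (('x \<Rightarrow> real) \<Rightarrow> 'v::real_vector) \<Rightarrow> bool" where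
  "linear_on_funs A \<rho> \<longleftrightarrow>
    (\<forall>f\<in>A. \<forall>g\<in>A. \<rho> (\<lambda>t. f t + g t) = \<rho> f + \<rho> g) \<and>
    (\<forall>c. \<forall>f\<in>A. \<rho> (\<lambda>t. c * f t) = c *\<^sub>R \<rho> f)"

definition positive_representation ::
    "('x \<Rightarrow> real) set \<Rightarrow> (('x \<Rightarrow> real) \<Rightarrow> 'e::banach_lattice \<Rightarrow>\<^sub>L 'e) \<Rightarrow> bool" where
  "positive_representation A \<rho> \<longleftrightarrow>
    linear_on_funs A \<rho> \<and>
    (\<forall>f\<in>A. \<forall>g\<in>A. \<rho> (\<lambda>t. f t * g t) = \<rho> f o\<^sub>L \<rho> g) \<and>
    (\<forall>f\<in>A. (\<forall>t. 0 \<le> f t) \<longrightarrow> positive_map (blinfun_apply (\<rho> f)))"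

text \<open>Boundedness and norm of a linear map from a function space \<open>A\<close> (with the supremum norm)
  into an operator space \<open>V\<close> carrying the norm \<open>N\<close>.\<close>

definition bounded_into ::
    "('x \<Rightarrow> real) set \<Rightarrow> 'v set \<Rightarrow> ('v \<Rightarrow> real) \<Rightarrow> (('x \<Rightarrow> real) \<Rightarrow> 'v) \<Rightarrow> bool" where
  "bounded_into A V N \<rho> \<longleftrightarrow>
    (\<forall>f\<in>A. \<rho> f \<in> V) \<and> (\<exists>C. \<forall>f\<in>A. N (\<rho> f) \<le> C * sup_norm f)"

definition map_norm ::
    "('x \<Rightarrow> real) set \<Rightarrow> ('v \<Rightarrow> real) \<Rightarrow> (('x \<Rightarrow> real) \<Rightarrow> 'v) \<Rightarrow> real" where
  "map_norm A N \<rho> = (SUP f\<in>{f\<in>A. sup_norm f \<le> 1}. N (\<rho> f))"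


definition positive_spectral_measure ::
    "'x topology \<Rightarrow> ('x set \<Rightarrow> 'e::banach_lattice \<Rightarrow>\<^sub>L 'e) \<Rightarrow> bool" where
  "positive_spectral_measure X P \<longleftrightarrow>
    (\<forall>D\<in>sets (borel_of X).
       P D \<in> regular_operators \<and> positive_map (blinfun_apply (P D)) \<and> P D o\<^sub>L P D = P D) \<and>
    P {} = 0 \<and>
    (\<forall>D1\<in>sets (borel_of X). \<forall>D2\<in>sets (borel_of X). P (D1 \<inter> D2) = P D1 o\<^sub>L P D2) \<and>
    (\<forall>D::nat \<Rightarrow> 'x set. range D \<subseteq> sets (borel_of X) \<longrightarrow> disjoint_family D \<longrightarrow>
       (\<forall>x. (\<lambda>n. P (D n) x) sums P (\<Union>n. D n) x))"

definition regular_borel_measure :: "'x topology \<Rightarrow> 'x measure \<Rightarrow> bool" where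
  "regular_borel_measure X M \<longleftrightarrow>
    sets M = sets (borel_of X) \<and>
    (\<forall>D\<in>sets M. emeasure M D = (INF U\<in>{U. openin X U \<and> D \<subseteq> U}. emeasure M U)) \<and>
    (\<forall>U. openin X U \<longrightarrow> emeasure M U = (SUP K\<in>{K. compactin X K \<and> K \<subseteq> U}. emeasure M K))"

definition regular_spectral_measure ::
    "'x topology \<Rightarrow> ('x set \<Rightarrow> 'e::banach_lattice \<Rightarrow>\<^sub>L 'e) \<Rightarrow> bool" where
  "regular_spectral_measure X P \<longleftrightarrow>
    (\<forall>(x::'e) (x'::'e \<Rightarrow>\<^sub>L real). \<exists>M1 M2.
       finite_measure M1 \<and> regular_borel_measure X M1 \<and>
       finite_measure M2 \<and> regular_borel_measure X M2 \<and>
       (\<forall>D\<in>sets (borel_of X). x' (P D x) = measure M1 D - measure M2 D))"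

text \<open>\<open>generated_representation X P \<rho>\<close>: on the bounded Borel functions, \<open>\<rho>\<close> is the bounded linear
  map generated by \<open>P\<close>. These conditions determine \<open>\<rho>\<close> on \<open>bounded_borel X\<close> because the simple
  functions are dense there.\<close>

definition generated_representation ::
    "'x topology \<Rightarrow> ('x set \<Rightarrow> 'e::banach_lattice \<Rightarrow>\<^sub>L 'e) \<Rightarrow> (('x \<Rightarrow> real) \<Rightarrow> 'e \<Rightarrow>\<^sub>L 'e) \<Rightarrow> bool"
  where
  "generated_representation X P \<rho> \<longleftrightarrow>
    linear_on_funs (bounded_borel X) \<rho> \<and>
    bounded_into (bounded_borel X) UNIV norm \<rho> \<and>
    (\<forall>D\<in>sets (borel_of X). \<rho> (indicator D) = P D)"

end

theory Submission
  imports Defs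
begin

text \<open>The generated representation is positive, because a nonnegative function is a uniform limit of
  positive combinations of indicators. Hence \<open>\<parallel>f\<parallel> P(X)\<close> dominates \<open>\<plusminus>\<pi>\<^sub>P(f)\<close>, and this bounds both
  the operator norm and the regular norm of \<open>\<pi>\<^sub>P(f)\<close> by \<open>\<parallel>f\<parallel> \<parallel>P(X)\<parallel>\<close>, with equality of the norms at
  the indicator of \<open>X\<close>. For regular \<open>P\<close>, a positive functional norming \<open>P(X) x\<close> and inner
  regularity show that \<open>P(X) x\<close> is nearly normed by \<open>\<pi>(f) x\<close> for some \<open>f\<close> in \<open>C\<^sub>0(X)\<close> with
  \<open>0 \<le> f \<le> 1\<close>.\<close>

section \<open>Positive functionals on Banach lattices\<close>

definition sublinear :: "('a::real_vector \<Rightarrow> real) \<Rightarrow> bool" where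
  "sublinear p \<longleftrightarrow>
    (\<forall>x y. p (x + y) \<le> p x + p y) \<and> (\<forall>x. \<forall>c\<ge>0. p (c *\<^sub>R x) \<le> c * p x)"

lemma sublinear_add: "sublinear p \<Longrightarrow> p (x + y) \<le> p x + p y"
  by (simp add: sublinear_def)

lemma sublinear_0:
  assumes "sublinear p"
  shows "p 0 = 0"
  using sublinear_add[OF assms, of 0 0] assms
  by (force simp: sublinear_def intro: antisym)

text \<open>The definition asks only for an inequality, which is easier to verify for infima;
  applying it with factor \<open>inverse c\<close> at \<open>c *\<^sub>R x\<close> gives the reverse
  one.\<close>

lemma sublinear_scale:
  assumes "sublinear p" "c \<ge> 0"
  shows "p (c *\<^sub>R x) = c * p x"
proof (cases "c = 0")
  case False
  with assms have "p (inverse c *\<^sub>R (c *\<^sub>R x)) \<le> inverse c * p (c *\<^sub>R x)"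
    unfolding sublinear_def by (metis inverse_nonnegative_iff_nonnegative)
  with False assms have "c * p x \<le> p (c *\<^sub>R x)"
    by (simp add: field_simps)
  with assms show ?thesis
    unfolding sublinear_def by (metis antisym)
qed (simp add: sublinear_0 assms)

lemma sublinear_minus_ge:
  assumes "sublinear p"
  shows "- p (- x) \<le> p x"
  using sublinear_add[OF assms, of x "- x"] sublinear_0[OF assms] by simp

text \<open>The largest sublinear functional below \<open>p\<close> that is at most \<open>- p z\<close> at \<open>- z\<close>. A minimal
  sublinear functional coincides with all of these, and is therefore linear.\<close>

definition tilt :: "('a::real_vector \<Rightarrow> real) \<Rightarrow> 'a \<Rightarrow> 'a \<Rightarrow> real" where
  "tilt p z y = (INF t\<in>{0..}. p (y + t *\<^sub>R z) - t * p z)"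

lemma tilt_le:
  assumes "sublinear p" "t \<ge> 0"
  shows "tilt p z y \<le> p (y + t *\<^sub>R z) - t * p z"
  unfolding tilt_def
proof (rule cINF_lower)
  \<comment> \<open>Subadditivity for the sum of \<open>y + s *\<^sub>R z\<close> and
    \<open>- y\<close> gives a lower bound independent of \<open>s\<close>, so the infimum is
    finite.\<close>
  have "- p (- y) \<le> p (y + s *\<^sub>R z) - s * p z" if "s \<ge> 0" for s
    using sublinear_add[OF assms(1), of "y + s *\<^sub>R z" "- y"] sublinear_scale[OF assms(1) that, of z]
    by simp
  then show "bdd_below ((\<lambda>t. p (y + t *\<^sub>R z) - t * p z) ` {0..})"
    by (intro bdd_belowI2[where m = "- p (- y)"]) auto
qed (use assms in auto)

lemma tilt_ge: "(\<And>t. t \<ge> 0 \<Longrightarrow> l \<le> p (y + t *\<^sub>R z) - t * p z) \<Longrightarrow> l \<le> tilt p z y"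
  unfolding tilt_def by (rule cINF_greatest) auto

lemma sublinear_tilt:
  assumes p: "sublinear p"
  shows "sublinear (tilt p z)"
  unfolding sublinear_def
proof (intro conjI allI impI)
  fix x y
  \<comment> \<open>Parameters \<open>s\<close> for \<open>x\<close> and \<open>t\<close> for
    \<open>y\<close> combine to \<open>s + t\<close> for \<open>x + y\<close>; the two infima are
    then taken one after the other.\<close>
  have "tilt p z (x + y) - (p (x + s *\<^sub>R z) - s * p z) \<le> p (y + t *\<^sub>R z) - t * p z"
    if "s \<ge> 0" "t \<ge> 0" for s t
    using tilt_le[OF p, of "s + t" z "x + y"] that
      sublinear_add[OF p, of "x + s *\<^sub>R z" "y + t *\<^sub>R z"]
    by (simp add: algebra_simps)
  then have "tilt p z (x + y) - (p (x + s *\<^sub>R z) - s * p z) \<le> tilt p z y" if "s \<ge> 0" for s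
    using that by (intro tilt_ge) auto
  then have "tilt p z (x + y) - tilt p z y \<le> tilt p z x"
    by (intro tilt_ge) (auto simp: algebra_simps)
  then show "tilt p z (x + y) \<le> tilt p z x + tilt p z y"
    by simp
next
  fix x and c :: real
  assume c: "c \<ge> 0"
  show "tilt p z (c *\<^sub>R x) \<le> c * tilt p z x"
  proof (cases "c = 0")
    case True
    then show ?thesis
      using tilt_le[OF p, of 0 z 0] sublinear_0[OF p] by simp
  next
    case False
    \<comment> \<open>Parameter \<open>t\<close> for \<open>x\<close> corresponds to
      \<open>c * t\<close> for \<open>c *\<^sub>R x\<close>.\<close>
    have "tilt p z (c *\<^sub>R x) / c \<le> p (x + t *\<^sub>R z) - t * p z" if "t \<ge> 0" for t
      using tilt_le[OF p, of "c * t" z "c *\<^sub>R x"] that c False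
        sublinear_scale[OF p c, of "x + t *\<^sub>R z"]
      by (simp add: field_simps scaleR_add_right)
    then have "tilt p z (c *\<^sub>R x) / c \<le> tilt p z x"
      by (rule tilt_ge)
    then show ?thesis
      using c False by (simp add: field_simps)
  qed
qed

lemma tilt_le_self: "sublinear p \<Longrightarrow> tilt p z y \<le> p y"
  using tilt_le[of p 0 z y] by simp

text \<open>Zorn's lemma for the reversed pointwise order: a nonempty chain has its pointwise
  infimum as a lower bound, finite because every sublinear \<open>q \<le> p\<close> satisfies
  \<open>- p (- y) \<le> q y\<close>.\<close>

lemma minimal_sublinear_ex:
  assumes p: "sublinear p"
  obtains q where "sublinear q" "q \<le> p" "\<And>r. sublinear r \<Longrightarrow> r \<le> q \<Longrightarrow> r = q"
proof -
  let ?A = "{q. sublinear q \<and> q \<le> p}"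
  have "\<exists>m\<in>?A. \<forall>a\<in>?A. a \<le> m \<longrightarrow> a = m"
  proof (rule predicate_Zorn[where P = "\<lambda>f g. g \<le> f"])
    show "partial_order_on ?A (relation_of (\<lambda>f g. g \<le> f) ?A)"
      by (rule partial_order_on_relation_ofI) auto
  next
    fix C
    assume "C \<in> Chains (relation_of (\<lambda>f g. g \<le> f) ?A)"
    then have CA: "C \<subseteq> ?A" and chain: "\<And>f g. f \<in> C \<Longrightarrow> g \<in> C \<Longrightarrow> f \<le> g \<or> g \<le> f"
      by (auto simp: Chains_def relation_of_def)
    show "\<exists>u\<in>?A. \<forall>a\<in>C. u \<le> a"
    proof (cases "C = {}")
      case True
      with p show ?thesis by auto
    next
      case False
      define u where "u y = (INF q\<in>C. q y)" for y
      have "- p (- y) \<le> q y" if "q \<in> C" for q y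
      proof -
        have "sublinear q" "q (- y) \<le> p (- y)"
          using that CA by (auto simp: le_fun_def)
        with sublinear_minus_ge[of q y] show ?thesis by simp
      qed
      then have u_le: "u y \<le> q y" if "q \<in> C" for q y
        unfolding u_def using that by (intro cINF_lower bdd_belowI2[where m = "- p (- y)"]) auto
      have u_ge: "l \<le> u y" if "\<And>q. q \<in> C \<Longrightarrow> l \<le> q y" for l y
        unfolding u_def using False that by (intro cINF_greatest) auto
      have "sublinear u"
        unfolding sublinear_def
      proof (intro conjI allI impI)
        fix x y
        have "u (x + y) - f x \<le> g y" if "f \<in> C" "g \<in> C" for f g
        proof -
          \<comment> \<open>The smaller of the two chain members serves both arguments at
            once.\<close>
          obtain h where h: "h \<in> C" "h \<le> f" "h \<le> g"
            using chain[OF \<open>f \<in> C\<close> \<open>g \<in> C\<close>] \<open>f \<in> C\<close> \<open>g \<in> C\<close> by auto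
          then have "h (x + y) \<le> f x + g y"
            using sublinear_add[of h x y] CA le_funD[OF h(2), of x] le_funD[OF h(3), of y] by auto
          with u_le[OF h(1), of "x + y"] show ?thesis by simp
        qed
        then have "u (x + y) - f x \<le> u y" if "f \<in> C" for f
          using that by (intro u_ge)
        then have "u (x + y) - u y \<le> u x"
          by (intro u_ge) (auto simp: algebra_simps)
        then show "u (x + y) \<le> u x + u y" by simp
      next
        fix x and c :: real
        assume c: "c \<ge> 0"
        show "u (c *\<^sub>R x) \<le> c * u x"
        proof (cases "c = 0")
          case True
          obtain f where "f \<in> C" using False by auto
          with True u_le[of f 0] sublinear_0[of f] CA show ?thesis by auto
        next
          case nz: False
          have "u (c *\<^sub>R x) / c \<le> f x" if "f \<in> C" for f
            using u_le[OF that, of "c *\<^sub>R x"] sublinear_scale[of f c x] c nz that CA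
            by (auto simp: field_simps)
          then have "u (c *\<^sub>R x) / c \<le> u x"
            by (rule u_ge)
          then show ?thesis
            using c nz by (simp add: field_simps)
        qed
      qed
      moreover have "u \<le> p"
      proof (rule le_funI)
        fix y
        obtain f where "f \<in> C" using False by auto
        then have "u y \<le> f y" "f y \<le> p y"
          using u_le CA by (auto simp: le_fun_def)
        then show "u y \<le> p y" by simp
      qed
      ultimately show ?thesis
        using u_le by (auto simp: le_fun_def)
    qed
  qed
  then obtain q where "q \<in> ?A" "\<And>r. r \<in> ?A \<Longrightarrow> r \<le> q \<Longrightarrow> r = q"
    by blast
  then show thesis
    by (intro that[of q]) (auto intro: order_trans)
qed

lemma minimal_sublinear_linear:
  assumes q: "sublinear q" and min: "\<And>r. sublinear r \<Longrightarrow> r \<le> q \<Longrightarrow> r = q"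
  shows "linear q"
proof -
  have "tilt q z = q" for z
    by (intro min sublinear_tilt q) (simp add: le_fun_def tilt_le_self q)
  \<comment> \<open>With \<open>tilt q z = q\<close>, the tilt bound at parameter 1 is
    superadditivity.\<close>
  then have "q (y + z) \<ge> q y + q z" for y z
    using tilt_le[OF q, of 1 z y] by simp
  then have add: "q (y + z) = q y + q z" for y z
    using sublinear_add[OF q] by (intro antisym)
  have neg: "q (- y) = - q y" for y
    using add[of y "- y"] sublinear_0[OF q] by simp
  show ?thesis
  proof (rule linearI)
    fix c y
    show "q (c *\<^sub>R y) = c *\<^sub>R q y"
      using sublinear_scale[OF q, of c y] sublinear_scale[OF q, of "- c" y] neg
      by (cases "c \<ge> 0") auto
  qed (rule add)
qed

text \<open>The minimal functional is taken below \<open>tilt p z\<close> instead of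
  \<open>p\<close>. This forces \<open>q (- z) \<le> - p z\<close>, so that linearity yields
  equality at \<open>z\<close>.\<close>

theorem Hahn_Banach_attained:
  assumes p: "sublinear p"
  obtains q where "linear q" "q \<le> p" "q z = p z"
proof -
  obtain q where q: "sublinear q" "q \<le> tilt p z" "\<And>r. sublinear r \<Longrightarrow> r \<le> q \<Longrightarrow> r = q"
    using minimal_sublinear_ex[OF sublinear_tilt[OF p]] by blast
  have lin: "linear q"
    using q by (intro minimal_sublinear_linear)
  have le: "q y \<le> p y" for y
    using q(2) tilt_le_self[OF p, of z y] by (auto simp: le_fun_def intro: order_trans)
  have "q (- z) \<le> - p z"
    using q(2) tilt_le[OF p, of 1 z "- z"] sublinear_0[OF p]
    by (auto simp: le_fun_def intro: order_trans)
  then have "q z = p z"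
    using le[of z] linear_neg[OF lin, of z] by simp
  with lin le show thesis
    by (intro that[of q]) (auto simp: le_fun_def)
qed

section \<open>Norming positive vectors by positive functionals\<close>

lemma norm_mono_nonneg:
  fixes x y :: "'e::banach_lattice"
  shows "0 \<le> x \<Longrightarrow> x \<le> y \<Longrightarrow> norm x \<le> norm y"
  by (rule norm_mono_abs) (simp add: order_trans)

lemma norm_abs_eq:
  fixes x :: "'e::banach_lattice"
  shows "norm \<bar>x\<bar> = norm x"
  by (intro antisym norm_mono_abs) auto

lemma sublinear_norm_pprt: "sublinear (\<lambda>y::'e::banach_lattice. norm (pprt y))"
  unfolding sublinear_def
proof (intro conjI allI impI)
  fix x y :: 'e
  have "pprt (x + y) \<le> pprt x + pprt y"
    by (simp add: pprt_def add_mono add_nonneg_nonneg)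
  then show "norm (pprt (x + y)) \<le> norm (pprt x) + norm (pprt y)"
    by (meson norm_mono_nonneg norm_triangle_ineq order_trans zero_le_pprt)
next
  fix x :: 'e and c :: real
  assume c: "c \<ge> 0"
  then have "pprt (c *\<^sub>R x) \<le> c *\<^sub>R pprt x"
    by (simp add: pprt_def scaleR_left_mono scaleR_nonneg_nonneg)
  then have "norm (pprt (c *\<^sub>R x)) \<le> norm (c *\<^sub>R pprt x)"
    by (meson norm_mono_nonneg zero_le_pprt)
  with c show "norm (pprt (c *\<^sub>R x)) \<le> c * norm (pprt x)"
    by simp
qed

text \<open>Dominating the functional by the norm of the positive part, rather than by the norm, makes it
  positive: it is nonpositive where the positive part vanishes.\<close>

lemma positive_norming_functional:
  fixes z :: "'e::banach_lattice"
  assumes "z \<ge> 0"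
  obtains \<phi> :: "'e \<Rightarrow>\<^sub>L real"
  where "\<And>y. y \<ge> 0 \<Longrightarrow> \<phi> y \<ge> 0" "\<And>y. \<bar>\<phi> y\<bar> \<le> norm y" "\<phi> z = norm z"
proof -
  obtain q where q: "linear q" "q \<le> (\<lambda>y::'e. norm (pprt y))" "q z = norm (pprt z)"
    using Hahn_Banach_attained[OF sublinear_norm_pprt] by blast
  have le: "q y \<le> norm (pprt y)" for y
    using q(2) by (simp add: le_fun_def)
  have pprt_le: "norm (pprt y) \<le> norm y" for y :: 'e
    using norm_mono_nonneg[of "pprt y" "\<bar>y\<bar>"] norm_abs_eq[of y] abs_ge_self[of y]
    by (simp add: pprt_def del: abs_ge_self)
  have abs: "\<bar>q y\<bar> \<le> norm y" for y
    using order_trans[OF le pprt_le, of y] order_trans[OF le pprt_le, of "- y"]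
    by (simp add: linear_neg[OF q(1)])
  have "bounded_linear q"
    using q(1) abs by (intro bounded_linear.intro bounded_linear_axioms.intro exI[of _ 1]) auto
  then have eq: "blinfun_apply (Blinfun q) = q"
    by (rule bounded_linear_Blinfun_apply)
  have "q y \<ge> 0" if "y \<ge> 0" for y
    using le[of "- y"] that by (simp add: linear_neg[OF q(1)])
  with abs q(3) assms eq show thesis
    by (intro that[of "Blinfun q"]) auto
qed

section \<open>Positive operators and the modulus\<close>

text \<open>The negative part of the limit \<open>l\<close> is dominated by the modulus of
  \<open>f n - l\<close>, whose norm tends to 0; hence it vanishes.\<close>

lemma closed_positive_cone: "closed {x::'e::banach_lattice. 0 \<le> x}"
  unfolding closed_sequential_limits
proof (intro allI impI, elim conjE)
  fix f and l :: 'e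
  assume f: "\<forall>n. f n \<in> {x. 0 \<le> x}" and lim: "f \<longlonglongrightarrow> l"
  have "norm (pprt (- l)) \<le> norm (f n - l)" for n
  proof -
    have "- l \<le> f n - l" using f by simp
    then have "- l \<le> \<bar>f n - l\<bar>" by (rule order_trans) (rule abs_ge_self)
    then have "pprt (- l) \<le> \<bar>f n - l\<bar>"
      unfolding pprt_def by (intro sup_least) auto
    then have "norm (pprt (- l)) \<le> norm \<bar>f n - l\<bar>"
      by (intro norm_mono_nonneg) auto
    then show ?thesis by (simp add: norm_abs_eq)
  qed
  moreover have "(\<lambda>n. norm (f n - l)) \<longlonglongrightarrow> 0"
    using lim by (simp add: LIM_zero tendsto_norm_zero)
  ultimately have "norm (pprt (- l)) \<le> 0"
    by (intro LIMSEQ_le_const) auto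
  then show "l \<in> {x. 0 \<le> x}"
    by (simp add: pprt_neg flip: zero_le_iff_zero_nprt)
qed

lemma op_le_iff: "op_le S T \<longleftrightarrow> (\<forall>x\<ge>0. S x \<le> T x)"
  by (simp add: op_le_def positive_map_def blinfun.diff_left)

lemma op_le_uminus_positive:
  assumes "positive_map (blinfun_apply S)" "positive_map (blinfun_apply T)"
  shows "op_le (- S) T"
  unfolding op_le_iff
proof (intro allI impI)
  fix x :: 'a
  assume "x \<ge> 0"
  then have "- S x \<le> 0" "0 \<le> T x"
    using assms by (simp_all add: positive_map_def)
  then show "(- S) x \<le> T x"
    by (simp add: blinfun.minus_left order_trans[of "- S x" 0])
qed

text \<open>The order compares operators only on the positive cone, but the cone spans the space.
  This makes the modulus unique.\<close>

lemma op_le_antisym: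
  fixes S T :: "'e::banach_lattice \<Rightarrow>\<^sub>L 'e"
  assumes "op_le S T" "op_le T S"
  shows "S = T"
proof (rule blinfun_eqI)
  fix x :: 'e
  have eq: "S y = T y" if "y \<ge> 0" for y
    using assms that by (auto simp: op_le_iff intro: antisym)
  have "x = pprt x - pprt (- x)"
    using prts[of x] by (simp add: pprt_neg)
  then show "S x = T x"
    by (metis blinfun.diff_right eq zero_le_pprt)
qed

text \<open>On the cone, adding the two bounds cancels \<open>T\<close> and leaves
  \<open>0 \<le> U x + U x\<close>.\<close>

lemma positive_map_if_dominates:
  assumes "op_le T U" "op_le (- T) U"
  shows "positive_map (blinfun_apply U)"
  unfolding positive_map_def
proof (intro allI impI)
  fix x :: 'a
  assume "x \<ge> 0"
  then have "T x + (- T) x \<le> U x + U x"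
    using assms unfolding op_le_iff by (blast intro: add_mono)
  then show "0 \<le> U x"
    by (simp add: blinfun.minus_left)
qed

lemma regular_operatorsI_diff:
  assumes "positive_map (blinfun_apply R)" "positive_map (blinfun_apply S)"
  shows "R - S \<in> regular_operators"
proof -
  have "linear (blinfun_apply R)" "linear (blinfun_apply S)"
    by (simp_all add: bounded_linear.linear blinfun.bounded_linear_right)
  moreover have "blinfun_apply (R - S) = (\<lambda>x. R x - S x)"
    by (simp add: fun_eq_iff blinfun.diff_left)
  ultimately show ?thesis
    unfolding regular_operators_def using assms by blast
qed

lemma regular_operatorsI_positive:
  "positive_map (blinfun_apply R) \<Longrightarrow> R \<in> regular_operators"
  using regular_operatorsI_diff[of R 0] by (simp add: positive_map_def)

text \<open>In \<open>T = U - (U - T)\<close> both terms are positive, the first because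
  \<open>U\<close> dominates \<open>T\<close> and \<open>- T\<close>.\<close>

lemma regular_operatorsI_dominated:
  assumes "op_le T U" "op_le (- T) U"
  shows "T \<in> regular_operators"
  using regular_operatorsI_diff[of U "U - T"] positive_map_if_dominates[OF assms] assms(1)
  by (simp add: op_le_def)

text \<open>Use the bound on \<open>T\<close> at the positive part of \<open>y\<close> and the bound
  on \<open>- T\<close> at the negative part; these parts add up to the modulus of
  \<open>y\<close>.\<close>

lemma apply_le_if_dominates:
  assumes "op_le T U" "op_le (- T) U"
  shows "T y \<le> U \<bar>y\<bar>"
proof -
  have "T (pprt y) + (- T) (pprt (- y)) \<le> U (pprt y) + U (pprt (- y))"
    using assms unfolding op_le_iff by (intro add_mono) auto
  moreover have "T (pprt y) + (- T) (pprt (- y)) = T (pprt y - pprt (- y))"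
    by (simp add: blinfun.minus_left blinfun.diff_right)
  moreover have "pprt y - pprt (- y) = y" "pprt y + pprt (- y) = \<bar>y\<bar>"
    using prts[of y] abs_prts[of y] by (simp_all add: pprt_neg)
  ultimately show ?thesis
    by (simp flip: blinfun.add_right)
qed

lemma abs_apply_le_if_dominates:
  assumes "op_le T U" "op_le (- T) U"
  shows "\<bar>T y\<bar> \<le> U \<bar>y\<bar>"
  using apply_le_if_dominates[OF assms, of y] apply_le_if_dominates[OF assms, of "- y"]
  by (intro abs_leI) (auto simp: blinfun.minus_right)

lemma norm_apply_le_norm_apply_abs:
  assumes "op_le T U" "op_le (- T) U"
  shows "norm (T y) \<le> norm (U \<bar>y\<bar>)"
  using abs_apply_le_if_dominates[OF assms, of y]
  by (intro norm_mono_abs) (meson abs_ge_self order_trans)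

lemma norm_le_if_dominates:
  assumes "op_le T U" "op_le (- T) U"
  shows "norm T \<le> norm U"
proof (rule norm_blinfun_bound)
  fix y
  show "norm (T y) \<le> norm U * norm y"
    using norm_apply_le_norm_apply_abs[OF assms, of y] norm_blinfun[of U "\<bar>y\<bar>"]
    by (simp add: norm_abs_eq)
qed simp

section \<open>The modulus of an operator and the regular norm\<close>

lemma Riesz_decomposition:
  fixes y a b :: "'e::banach_lattice"
  assumes "a \<ge> 0" "b \<ge> 0" "\<bar>y\<bar> \<le> a + b"
  obtains u v where "y = u + v" "\<bar>u\<bar> \<le> a" "\<bar>v\<bar> \<le> b"
proof
  \<comment> \<open>\<open>u\<close> truncates \<open>y\<close> to the order interval from
    \<open>- a\<close> to \<open>a\<close>; what is cut off has modulus at most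
    \<open>b\<close>.\<close>
  define u where "u = sup (- a) (inf y a)"
  have y: "y \<le> a + b" "- y \<le> a + b"
    using assms(3) abs_le_D1 abs_le_D2 by blast+
  show "y = u + (y - u)" by simp
  have "- a \<le> a" using assms(1) by (meson neg_le_0_iff_le order_trans)
  then show "\<bar>u\<bar> \<le> a"
    unfolding u_def by (intro abs_leI) (auto simp: neg_sup_eq_inf intro: le_infI1 le_supI1)
  have "y - b \<le> inf y a"
    using y assms(2) by (simp add: diff_le_eq)
  also have "\<dots> \<le> u"
    by (simp add: u_def)
  finally have "y - u \<le> b"
    by (simp add: algebra_simps)
  moreover have "u \<le> y + b"
    unfolding u_def
  proof (rule sup_least)
    show "- a \<le> y + b" using add_right_mono[OF y(2), of "y - a"] by (simp add: algebra_simps)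
    show "inf y a \<le> y + b" using assms(2) by (intro le_infI1) simp
  qed
  ultimately show "\<bar>y - u\<bar> \<le> b"
    by (intro abs_leI) (auto simp: algebra_simps)
qed

text \<open>Additivity on the cone makes \<open>m a - m b\<close> depend on \<open>a - b\<close>
  only (\<open>M_diff\<close>). Linearity then follows by choosing a convenient decomposition for
  each sum or multiple.\<close>

lemma linear_extension_of_cone_map:
  fixes m :: "'e::banach_lattice \<Rightarrow> 'b::real_vector"
  assumes add: "\<And>x y. x \<ge> 0 \<Longrightarrow> y \<ge> 0 \<Longrightarrow> m (x + y) = m x + m y"
    and scale: "\<And>c x. c \<ge> 0 \<Longrightarrow> x \<ge> 0 \<Longrightarrow> m (c *\<^sub>R x) = c *\<^sub>R m x"
  obtains M where "linear M" "\<And>x. x \<ge> 0 \<Longrightarrow> M x = m x"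
proof
  define M where "M x = m (pprt x) - m (pprt (- x))" for x
  have m0: "m 0 = 0"
    using scale[of 0 0] by simp
  have M_diff: "M (a - b) = m a - m b" if "a \<ge> 0" "b \<ge> 0" for a b
  proof -
    have "pprt (a - b) - pprt (- (a - b)) = a - b"
      using prts[of "a - b"] by (simp add: pprt_neg[of "a - b"] del: minus_diff_eq)
    then have "pprt (a - b) + b = a + pprt (- (a - b))"
      by (simp only: algebra_simps)
    then have "m (pprt (a - b)) + m b = m a + m (pprt (- (a - b)))"
      using that by (metis add zero_le_pprt)
    then show ?thesis
      unfolding M_def by (simp add: algebra_simps)
  qed
  have parts: "x = pprt x - pprt (- x)" for x :: 'e
    using prts[of x] by (simp add: pprt_neg)
  show "M x = m x" if "x \<ge> 0" for x
    using M_diff[of x 0] that m0 by simp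
  show "linear M"
  proof (rule linearI)
    fix x y :: 'e
    have "x + y = (pprt x + pprt y) - (pprt (- x) + pprt (- y))"
      using arg_cong2[OF parts[of x] parts[of y], of "(+)"] by (simp only: algebra_simps)
    then have "M (x + y) = m (pprt x + pprt y) - m (pprt (- x) + pprt (- y))"
      by (simp only:) (intro M_diff add_nonneg_nonneg zero_le_pprt)
    then show "M (x + y) = M x + M y"
      by (simp add: add M_def)
  next
    fix c and x :: 'e
    show "M (c *\<^sub>R x) = c *\<^sub>R M x"
    proof (cases "c \<ge> 0")
      case True
      have "c *\<^sub>R x = c *\<^sub>R pprt x - c *\<^sub>R pprt (- x)"
        using parts[of x] by (metis scaleR_diff_right)
      then have "M (c *\<^sub>R x) = m (c *\<^sub>R pprt x) - m (c *\<^sub>R pprt (- x))"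
        using True by (simp only:) (intro M_diff scaleR_nonneg_nonneg zero_le_pprt)
      with True show ?thesis
        by (simp add: scale M_def scaleR_diff_right)
    next
      case False
      \<comment> \<open>A negative factor exchanges the positive and negative parts; the factor
        \<open>- c\<close> keeps both terms in the cone.\<close>
      have "c *\<^sub>R x = (- c) *\<^sub>R pprt (- x) - (- c) *\<^sub>R pprt x"
        using parts[of x] by (metis minus_diff_eq scaleR_diff_right scaleR_minus_left scaleR_minus_right)
      then have "M (c *\<^sub>R x) = m ((- c) *\<^sub>R pprt (- x)) - m ((- c) *\<^sub>R pprt x)"
        using False by (simp only:) (intro M_diff scaleR_nonneg_nonneg zero_le_pprt; simp)
      with False show ?thesis
        using scale[of "- c" "pprt x"] scale[of "- c" "pprt (- x)"]
        by (simp add: M_def scaleR_diff_right)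
    qed
  qed
qed

lemma abs_scaleR_le:
  fixes x :: "'e::banach_lattice"
  assumes "c \<ge> 0"
  shows "\<bar>c *\<^sub>R x\<bar> \<le> c *\<^sub>R \<bar>x\<bar>"
  using assms scaleR_left_mono[OF abs_ge_self[of x] assms]
    scaleR_left_mono[OF abs_ge_minus_self[of x] assms]
  by (intro abs_leI) auto

text \<open>The modulus is given on the cone by the Riesz--Kantorovich formula
  \<open>|T| x = sup {T y. |y| \<le> x}\<close>; a bounded dominating operator makes it bounded without an appeal to
  automatic continuity.\<close>

lemma is_op_modulus_ex:
  fixes T U :: "'e::banach_lattice \<Rightarrow>\<^sub>L 'e"
  assumes dc: "dedekind_complete TYPE('e)" and T: "op_le T U" "op_le (- T) U"
  shows "\<exists>M. is_op_modulus T M"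
proof -
  \<comment> \<open>With \<open>V = U\<close> this bounds the sets whose suprema are taken; with
    arbitrary \<open>V\<close> it gives leastness of the modulus at the end.\<close>
  have le: "T y \<le> V x" if "\<bar>y\<bar> \<le> x" "op_le T V" "op_le (- T) V" for V x y
  proof -
    have "V \<bar>y\<bar> \<le> V x"
      using positive_map_if_dominates[OF that(2,3)] that(1)
      by (metis blinfun.diff_right diff_ge_0_iff_ge positive_map_def)
    with apply_le_if_dominates[OF that(2,3), of y] show ?thesis by (rule order_trans)
  qed
  have "\<exists>s. (\<forall>y. \<bar>y\<bar> \<le> x \<longrightarrow> T y \<le> s) \<and> (\<forall>u. (\<forall>y. \<bar>y\<bar> \<le> x \<longrightarrow> T y \<le> u) \<longrightarrow> s \<le> u)"
    if "x \<ge> 0" for x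
  proof -
    have "bdd_above {T y |y. \<bar>y\<bar> \<le> x}"
      using le T by (intro bdd_aboveI[of _ "U x"]) auto
    moreover have "{T y |y. \<bar>y\<bar> \<le> x} \<noteq> {}"
      using that by (auto intro: exI[of _ 0])
    ultimately obtain s where "\<forall>a\<in>{T y |y. \<bar>y\<bar> \<le> x}. a \<le> s"
      "\<forall>u. (\<forall>a\<in>{T y |y. \<bar>y\<bar> \<le> x}. a \<le> u) \<longrightarrow> s \<le> u"
      using dc[unfolded dedekind_complete_def, THEN spec[of _ "{T y |y. \<bar>y\<bar> \<le> x}"]] by blast
    then show ?thesis by (intro exI[of _ s]) blast
  qed
  then obtain m where ub: "\<And>x y. x \<ge> 0 \<Longrightarrow> \<bar>y\<bar> \<le> x \<Longrightarrow> T y \<le> m x"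
    and least: "\<And>x u. x \<ge> 0 \<Longrightarrow> (\<And>y. \<bar>y\<bar> \<le> x \<Longrightarrow> T y \<le> u) \<Longrightarrow> m x \<le> u"
    by metis
  have add: "m (a + b) = m a + m b" if ab: "a \<ge> 0" "b \<ge> 0" for a b
  proof (rule antisym)
    show "m (a + b) \<le> m a + m b"
    proof (rule least)
      fix y
      assume "\<bar>y\<bar> \<le> a + b"
      then obtain u v where "y = u + v" "\<bar>u\<bar> \<le> a" "\<bar>v\<bar> \<le> b"
        using Riesz_decomposition ab by blast
      with ab show "T y \<le> m a + m b"
        by (simp add: blinfun.add_right add_mono ub)
    qed (use ab in simp)
    \<comment> \<open>Superadditivity: first the supremum over \<open>v\<close> with
      \<open>u\<close> fixed, then the supremum over \<open>u\<close>.\<close>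
    have "T v + T u \<le> m (a + b)" if "\<bar>u\<bar> \<le> a" "\<bar>v\<bar> \<le> b" for u v
      using ub[of "a + b" "v + u"] ab that order_trans[OF abs_triangle_ineq add_mono, of v b u a]
      by (simp add: blinfun.add_right add.commute[of a b])
    then have "m b \<le> m (a + b) - T u" if "\<bar>u\<bar> \<le> a" for u
      using ab that by (intro least) (simp_all add: le_diff_eq)
    then have "T u \<le> m (a + b) - m b" if "\<bar>u\<bar> \<le> a" for u
      using that by (metis add.commute le_diff_eq)
    then have "m a \<le> m (a + b) - m b"
      using ab by (intro least)
    then show "m a + m b \<le> m (a + b)"
      by (simp add: algebra_simps)
  qed
  have scale_le: "m (c *\<^sub>R x) \<le> c *\<^sub>R m x" if "c > 0" "x \<ge> 0" for c x
  proof (rule least)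
    fix y
    assume "\<bar>y\<bar> \<le> c *\<^sub>R x"
    then have "inverse c *\<^sub>R \<bar>y\<bar> \<le> x"
      using scaleR_left_mono[of "\<bar>y\<bar>" "c *\<^sub>R x" "inverse c"] that by simp
    then have "\<bar>inverse c *\<^sub>R y\<bar> \<le> x"
      using abs_scaleR_le[of "inverse c" y] that by (auto intro: order_trans)
    then have "c *\<^sub>R T (inverse c *\<^sub>R y) \<le> c *\<^sub>R m x"
      using that by (intro scaleR_left_mono ub) auto
    with that show "T y \<le> c *\<^sub>R m x"
      by (simp add: blinfun.scaleR_right)
  qed (use that in \<open>simp add: scaleR_nonneg_nonneg\<close>)
  have scale: "m (c *\<^sub>R x) = c *\<^sub>R m x" if c: "c \<ge> 0" and x: "x \<ge> 0" for c x
  proof (cases "c = 0")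
    case True
    then show ?thesis using add[of 0 0] by simp
  next
    case False
    with c have c: "c > 0" by simp
    then have "m (inverse c *\<^sub>R (c *\<^sub>R x)) \<le> inverse c *\<^sub>R m (c *\<^sub>R x)"
      using x by (intro scale_le) (auto simp: scaleR_nonneg_nonneg)
    then have "c *\<^sub>R m x \<le> c *\<^sub>R (inverse c *\<^sub>R m (c *\<^sub>R x))"
      using c by (intro scaleR_left_mono) auto
    with c scale_le[OF c x] show ?thesis by (simp add: antisym)
  qed
  obtain M where M: "linear M" "\<And>x. x \<ge> 0 \<Longrightarrow> M x = m x"
    using linear_extension_of_cone_map[of m] add scale by blast
  have "m x \<ge> 0" if "x \<ge> 0" for x
    using ub[of x 0] that by simp
  then have pos: "0 \<le> M x" if "x \<ge> 0" for x
    using M(2) that by simp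
  have mono: "M x \<le> M y" if "x \<le> y" for x y
    using pos[of "y - x"] that by (simp add: linear_diff[OF M(1)])
  have "norm (M x) \<le> norm x * norm U" for x
  proof -
    have "\<bar>M x\<bar> \<le> M \<bar>x\<bar>"
      using mono[OF abs_ge_self[of x]] mono[OF abs_ge_minus_self[of x]]
      by (intro abs_leI) (simp_all add: linear_neg[OF M(1)])
    moreover have "M \<bar>x\<bar> \<le> U \<bar>x\<bar>"
      using M(2) le T by (simp add: least)
    ultimately have "norm (M x) \<le> norm (U \<bar>x\<bar>)"
      by (intro norm_mono_abs) (meson abs_ge_self order_trans)
    with norm_blinfun[of U "\<bar>x\<bar>"] show ?thesis
      by (simp add: norm_abs_eq mult.commute)
  qed
  then have "bounded_linear M"
    using M(1) by (intro bounded_linear.intro bounded_linear_axioms.intro exI[of _ "norm U"]) auto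
  then have eq: "blinfun_apply (Blinfun M) = M"
    by (rule bounded_linear_Blinfun_apply)
  have "is_op_modulus T (Blinfun M)"
    unfolding is_op_modulus_def
  proof (intro conjI ballI impI)
    show "Blinfun M \<in> regular_operators"
      using pos by (intro regular_operatorsI_positive) (simp add: eq positive_map_def)
    show "op_le T (Blinfun M)"
      by (simp add: op_le_iff eq M(2) ub)
    \<comment> \<open>The set of \<open>y\<close> with modulus at most \<open>x\<close> is
      symmetric, so the supremum dominates \<open>- T\<close> too.\<close>
    show "op_le (- T) (Blinfun M)"
      using ub[of _ "- _"] by (simp add: op_le_iff eq M(2) blinfun.minus_left blinfun.minus_right)
    show "op_le (Blinfun M) V" if "op_le T V" "op_le (- T) V" for V
      using that le by (simp add: op_le_iff eq M(2) least)
  qed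
  then show ?thesis ..
qed

lemma is_op_modulus_op_modulus:
  fixes T U :: "'e::banach_lattice \<Rightarrow>\<^sub>L 'e"
  assumes "dedekind_complete TYPE('e)" "op_le T U" "op_le (- T) U"
  shows "is_op_modulus T (op_modulus T)"
proof -
  have "\<exists>!M. is_op_modulus T M"
    using is_op_modulus_ex[OF assms] by (auto simp: is_op_modulus_def intro: op_le_antisym)
  then show ?thesis
    unfolding op_modulus_def by (rule theI')
qed

lemma norm_le_regular_norm:
  fixes T U :: "'e::banach_lattice \<Rightarrow>\<^sub>L 'e"
  assumes "dedekind_complete TYPE('e)" "op_le T U" "op_le (- T) U"
  shows "norm T \<le> regular_norm T"
  unfolding regular_norm_def using is_op_modulus_op_modulus[OF assms]
  by (intro norm_le_if_dominates) (auto simp: is_op_modulus_def)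

text \<open>Leastness puts the modulus below the regular operator \<open>U\<close>. Both are
  positive, so \<open>U\<close> also dominates the negative of the modulus, and domination compares
  operator norms.\<close>

lemma regular_norm_le:
  fixes T U :: "'e::banach_lattice \<Rightarrow>\<^sub>L 'e"
  assumes "dedekind_complete TYPE('e)" "op_le T U" "op_le (- T) U"
  shows "regular_norm T \<le> norm U"
proof -
  have mod: "is_op_modulus T (op_modulus T)"
    by (rule is_op_modulus_op_modulus[OF assms])
  have "positive_map (blinfun_apply (op_modulus T))" "positive_map (blinfun_apply U)"
    using mod assms by (auto simp: is_op_modulus_def intro: positive_map_if_dominates)
  moreover from this have "op_le (op_modulus T) U"
    using mod assms by (simp add: is_op_modulus_def regular_operatorsI_positive)
  moreover from calculation have "op_le (- op_modulus T) U"
    by (intro op_le_uminus_positive)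
  ultimately show ?thesis
    unfolding regular_norm_def by (intro norm_le_if_dominates)
qed

section \<open>Continuous and Borel functions\<close>

lemma space_borel_of: "space (borel_of X) = topspace X"
  by (simp add: borel_of_def space_measure_of_conv)

lemma openin_imp_borel:
  assumes "openin X U"
  shows "U \<in> sets (borel_of X)"
proof -
  have "{U. openin X U} \<subseteq> Pow (topspace X)"
    using openin_subset by blast
  with assms show ?thesis
    by (simp add: borel_of_def sets_measure_of)
qed

lemma compactin_imp_borel:
  assumes "Hausdorff_space X" "compactin X K"
  shows "K \<in> sets (borel_of X)"
proof -
  have "closedin X K"
    using assms compactin_imp_closedin by blast
  then have "openin X (topspace X - K)" and K: "K = topspace X - (topspace X - K)"
    by (auto simp: closedin_def)
  then have "space (borel_of X) - (topspace X - K) \<in> sets (borel_of X)"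
    by (intro sets.compl_sets openin_imp_borel)
  with K show ?thesis
    by (simp add: space_borel_of)
qed

lemma C0_subset_bounded_borel: "C0 X \<subseteq> bounded_borel X"
proof
  fix f
  assume f: "f \<in> C0 X"
  then have cont: "continuous_map X euclideanreal f" and 0: "\<And>t. t \<notin> topspace X \<Longrightarrow> f t = 0"
    by (auto simp: C0_def)
  have "f \<in> borel_measurable (borel_of X)"
  proof (rule borel_measurableI)
    fix S :: "real set"
    assume "open S"
    then have "openin X {t \<in> topspace X. f t \<in> S}"
      using openin_continuous_map_preimage[OF cont] by simp
    moreover have "f -` S \<inter> space (borel_of X) = {t \<in> topspace X. f t \<in> S}"
      by (auto simp: space_borel_of)
    ultimately show "f -` S \<inter> space (borel_of X) \<in> sets (borel_of X)"
      by (simp add: openin_imp_borel)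
  qed
  moreover have "bounded (range f)"
  proof -
    \<comment> \<open>The level 1 is arbitrary: compactness bounds \<open>f\<close> on
      \<open>K\<close>, and the level bounds it elsewhere.\<close>
    obtain K where K: "compactin X K" "\<And>t. t \<in> topspace X - K \<Longrightarrow> \<bar>f t\<bar> < 1"
      using f unfolding C0_def by (auto dest: spec[of _ 1])
    have "compact (f ` K)"
      using image_compactin[OF K(1) cont] by simp
    then have "bounded (f ` K \<union> cball 0 1)"
      by (simp add: compact_imp_bounded)
    moreover have "range f \<subseteq> f ` K \<union> cball 0 1"
      using K(2) 0 by (force simp: less_imp_le)
    ultimately show ?thesis
      by (rule bounded_subset)
  qed
  ultimately show "f \<in> bounded_borel X"
    using 0 by (simp add: bounded_borel_def)
qed

lemma bounded_borel_add:
  assumes "f \<in> bounded_borel X" "g \<in> bounded_borel X"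
  shows "(\<lambda>t. f t + g t) \<in> bounded_borel X"
  using assms bounded_plus_comp[of f UNIV g] by (auto simp: bounded_borel_def)

lemma bounded_borel_scale:
  assumes "f \<in> bounded_borel X"
  shows "(\<lambda>t. c * f t) \<in> bounded_borel X"
  using assms bounded_scaleR_comp[of f UNIV c] by (auto simp: bounded_borel_def)

lemma bounded_borel_diff:
  assumes "f \<in> bounded_borel X" "g \<in> bounded_borel X"
  shows "(\<lambda>t. f t - g t) \<in> bounded_borel X"
  using bounded_borel_add[OF assms(1) bounded_borel_scale[OF assms(2), of "-1"]] by simp

lemma indicator_bounded_borel:
  assumes "D \<in> sets (borel_of X)"
  shows "indicator D \<in> bounded_borel X"
proof -
  have "D \<subseteq> topspace X"
    using sets.sets_into_space[OF assms] by (simp add: space_borel_of)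
  moreover have "bounded (range (indicator D :: _ \<Rightarrow> real))"
    by (intro boundedI[of _ 1]) (auto simp: indicator_def)
  ultimately show ?thesis
    using assms by (auto simp: bounded_borel_def indicator_def)
qed

lemma sup_norm_le: "(\<And>t. \<bar>f t\<bar> \<le> c) \<Longrightarrow> sup_norm f \<le> c"
  unfolding sup_norm_def by (rule cSUP_least) auto

lemma abs_le_sup_norm:
  assumes "f \<in> bounded_borel X"
  shows "\<bar>f t\<bar> \<le> sup_norm f"
proof -
  have "bounded (range f)"
    using assms by (simp add: bounded_borel_def)
  then have "bdd_above (range (\<lambda>t. \<bar>f t\<bar>))"
    unfolding bounded_iff by (auto intro: bdd_aboveI2)
  then show ?thesis
    unfolding sup_norm_def by (rule cSUP_upper[OF UNIV_I])
qed

lemma sup_norm_nonneg: "f \<in> bounded_borel X \<Longrightarrow> 0 \<le> sup_norm f"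
  by (rule order_trans[OF abs_ge_zero abs_le_sup_norm])

text \<open>Choose an open \<open>U\<close> around \<open>K\<close> inside a compact
  \<open>L\<close>, and separate \<open>K\<close> from the complement of \<open>U\<close>. The
  resulting function vanishes off \<open>L\<close>, hence at infinity.\<close>

lemma C0_Urysohn:
  assumes "Hausdorff_space X" "locally_compact_space X" "compactin X K"
  obtains f where "f \<in> C0 X" "\<And>t. 0 \<le> f t" "\<And>t. f t \<le> 1" "\<And>t. t \<in> K \<Longrightarrow> f t = 1"
proof -
  obtain U L where U: "openin X U" "K \<subseteq> U" and L: "compactin X L" "U \<subseteq> L"
    using assms locally_compact_space_compact_closed_compact[of X] by meson
  have "completely_regular_space X"
    using assms locally_compact_regular_imp_completely_regular_space by blast
  moreover have "closedin X (topspace X - U)" "disjnt K (topspace X - U)"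
    using U by (auto simp: disjnt_def)
  ultimately obtain g where g: "continuous_map X (top_of_set {0..1::real}) g"
      "g ` (topspace X - U) \<subseteq> {0}" "g ` K \<subseteq> {1}"
    using Urysohn_completely_regular_compact_closed[of 0 1 X K "topspace X - U"] assms(3)
    by auto
  \<comment> \<open>Elements of \<open>C0 X\<close> are zero off \<open>topspace X\<close>, where
    \<open>g\<close> is arbitrary.\<close>
  define f where "f t = (if t \<in> topspace X then g t else 0)" for t
  have range: "g t \<in> {0..1}" if "t \<in> topspace X" for t
    using g(1) that by (auto simp: continuous_map_in_subtopology)
  have "continuous_map X euclideanreal g"
    using g(1) by (simp add: continuous_map_in_subtopology)
  then have "continuous_map X euclideanreal f"
    by (rule continuous_map_eq) (simp add: f_def)
  moreover have "\<bar>f t\<bar> < e" if "e > 0" "t \<in> topspace X - L" for e t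
  proof -
    have "g t = 0"
      using that g(2) L(2) by blast
    with that show ?thesis by (simp add: f_def)
  qed
  ultimately have "f \<in> C0 X"
    using L(1) by (auto simp: C0_def f_def)
  moreover have "f t = 1" if "t \<in> K" for t
    using that g(3) compactin_subset_topspace[OF assms(3)] by (auto simp: f_def)
  ultimately show thesis
    using range by (intro that[of f]) (auto simp: f_def)
qed

section \<open>Representations generated by positive spectral measures\<close>

locale positive_generated_representation =
  fixes X :: "'x topology"
    and P :: "'x set \<Rightarrow> ('e::banach_lattice \<Rightarrow>\<^sub>L 'e)"
    and \<rho> :: "('x \<Rightarrow> real) \<Rightarrow> ('e \<Rightarrow>\<^sub>L 'e)"
  assumes generated: "generated_representation X P \<rho>"
    and positive: "D \<in> sets (borel_of X) \<Longrightarrow> positive_map (blinfun_apply (P D))"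
begin

lemma rep_add:
  "f \<in> bounded_borel X \<Longrightarrow> g \<in> bounded_borel X \<Longrightarrow> \<rho> (\<lambda>t. f t + g t) = \<rho> f + \<rho> g"
  using generated by (simp add: generated_representation_def linear_on_funs_def)

lemma rep_scale: "f \<in> bounded_borel X \<Longrightarrow> \<rho> (\<lambda>t. c * f t) = c *\<^sub>R \<rho> f"
  using generated by (simp add: generated_representation_def linear_on_funs_def)

lemma rep_diff:
  assumes "f \<in> bounded_borel X" "g \<in> bounded_borel X"
  shows "\<rho> (\<lambda>t. f t - g t) = \<rho> f - \<rho> g"
  using rep_add[OF assms(1) bounded_borel_scale[OF assms(2), of "-1"]] rep_scale[OF assms(2), of "-1"]
  by simp

lemma rep_indicator: "D \<in> sets (borel_of X) \<Longrightarrow> \<rho> (indicator D) = P D"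
  using generated by (simp add: generated_representation_def)

text \<open>A nonnegative constant allows any uniform bound \<open>c\<close> in place of the
  supremum norm, as needed for the approximation error \<open>1 / n\<close>.\<close>

lemma rep_bounded:
  obtains C where "C \<ge> 0" "\<And>f c. f \<in> bounded_borel X \<Longrightarrow> (\<And>t. \<bar>f t\<bar> \<le> c) \<Longrightarrow> norm (\<rho> f) \<le> C * c"
proof -
  obtain C where C: "\<And>f. f \<in> bounded_borel X \<Longrightarrow> norm (\<rho> f) \<le> C * sup_norm f"
    using generated by (auto simp: generated_representation_def bounded_into_def)
  have "norm (\<rho> f) \<le> \<bar>C\<bar> * c" if "f \<in> bounded_borel X" "\<And>t. \<bar>f t\<bar> \<le> c" for f c
  proof -
    have "C * sup_norm f \<le> \<bar>C\<bar> * c"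
      using that by (intro mult_mono sup_norm_le sup_norm_nonneg) auto
    with C[OF that(1)] show ?thesis by simp
  qed
  then show thesis
    by (intro that[of "\<bar>C\<bar>"]) auto
qed

text \<open>A nonnegative function is within \<open>1 / n\<close> of its staircase
  \<open>\<lfloor>n f\<rfloor> / n = (\<Sum>k=1..N. indicator {n f \<ge> k} / n)\<close>, a combination of indicators with positive
  coefficients.\<close>

lemma positive_rep:
  assumes f: "f \<in> bounded_borel X" and nonneg: "\<And>t. 0 \<le> f t"
  shows "positive_map (blinfun_apply (\<rho> f))"
proof -
  define D where "D n k = {t \<in> topspace X. real k \<le> real n * f t}" for n k :: nat
  define s where "s n N t = (\<Sum>k=1..N. inverse (real n) * indicator (D n k) t)" for n N and t :: 'x
  have meas: "f \<in> borel_measurable (borel_of X)"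
    using f by (simp add: bounded_borel_def)
  have "{t \<in> space (borel_of X). real k \<le> real n * f t} \<in> sets (borel_of X)" for n k
    using meas by measurable
  then have D: "D n k \<in> sets (borel_of X)" for n k
    by (simp add: D_def space_borel_of)
  \<comment> \<open>Membership and positivity go through one induction, because additivity of
    \<open>\<rho>\<close> applies only to members.\<close>
  have s: "s n N \<in> bounded_borel X \<and> positive_map (blinfun_apply (\<rho> (s n N)))" for n N
  proof (induction N)
    case 0
    have "indicator {} \<in> bounded_borel X"
      by (rule indicator_bounded_borel) simp
    moreover have "s n 0 = indicator {}"
      by (simp add: s_def fun_eq_iff)
    ultimately show ?case
      using positive[of "{}"] rep_indicator[of "{}"] by (simp only: sets.empty_sets)
  next
    case (Suc N)
    have eq: "s n (Suc N) = (\<lambda>t. s n N t + inverse (real n) * indicator (D n (Suc N)) t)"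
      by (simp add: s_def fun_eq_iff)
    have "\<rho> (s n (Suc N)) = \<rho> (s n N) + inverse (real n) *\<^sub>R P (D n (Suc N))"
      unfolding eq using Suc D
      by (subst rep_add) (auto simp: bounded_borel_scale indicator_bounded_borel rep_scale rep_indicator)
    moreover have "s n (Suc N) \<in> bounded_borel X"
      unfolding eq using Suc D
      by (intro bounded_borel_add bounded_borel_scale indicator_bounded_borel) auto
    ultimately show ?case
      using Suc positive[OF D[of n "Suc N"]]
      by (simp add: positive_map_def blinfun.add_left blinfun.scaleR_left scaleR_nonneg_nonneg)
  qed
  obtain C where C: "C \<ge> 0"
    "\<And>f c. f \<in> bounded_borel X \<Longrightarrow> (\<And>t. \<bar>f t\<bar> \<le> c) \<Longrightarrow> norm (\<rho> f) \<le> C * c"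
    using rep_bounded by blast
  \<comment> \<open>Since \<open>n * f t\<close> never exceeds \<open>n * sup_norm f\<close>, higher
    levels contribute nothing.\<close>
  define N where "N n = nat \<lfloor>real n * sup_norm f\<rfloor>" for n :: nat
  have N: "\<bar>s n (N n) t - f t\<bar> \<le> 1 / real n" if n: "n > 0" for n t
  proof -
    define m where "m = nat \<lfloor>real n * f t\<rfloor>"
    have m: "real m \<le> real n * f t" "real n * f t < real m + 1"
      using nonneg[of t] by (simp_all add: m_def)
    have "real n * f t \<le> real n * sup_norm f"
      using abs_le_sup_norm[OF f, of t] by (intro mult_left_mono) auto
    then have "m \<le> N n"
      unfolding m_def N_def by (intro nat_mono floor_mono)
    have "t \<in> D n k \<longleftrightarrow> k \<le> m" if "k \<ge> 1" for k
    proof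
      show "k \<le> m" if "t \<in> D n k"
        using that m(2) by (simp add: D_def)
      \<comment> \<open>Level sets lie in \<open>topspace X\<close>; \<open>k \<ge> 1\<close> makes
        \<open>f t\<close> nonzero, which places \<open>t\<close> there.\<close>
      assume "k \<le> m"
      then have k: "real k \<le> real n * f t" using m(1) by simp
      with \<open>k \<ge> 1\<close> have "f t \<noteq> 0" by auto
      with k show "t \<in> D n k"
        using f by (auto simp: D_def bounded_borel_def)
    qed
    then have "s n (N n) t = (\<Sum>k\<in>{1..N n}. if k \<in> {1..m} then inverse (real n) else 0)"
      unfolding s_def by (intro sum.cong) (auto simp: indicator_def)
    also have "\<dots> = (\<Sum>k\<in>{1..m}. inverse (real n))"
      using \<open>m \<le> N n\<close> by (intro sum.mono_neutral_cong_right) auto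
    also have "\<dots> = real m / real n"
      by (simp add: divide_inverse)
    finally show "\<bar>s n (N n) t - f t\<bar> \<le> 1 / real n"
      using m n by (simp add: field_simps abs_le_iff)
  qed
  show ?thesis
    unfolding positive_map_def
  proof (intro allI impI)
    fix x :: 'e
    assume "x \<ge> 0"
    \<comment> \<open>The index \<open>Suc n\<close> keeps the staircase width \<open>1 / n\<close>
      away from division by zero.\<close>
    have "norm (\<rho> (s (Suc n) (N (Suc n))) - \<rho> f) \<le> C * (1 / real (Suc n))" for n
      using C(2)[OF bounded_borel_diff[OF conjunct1[OF s] f] N[of "Suc n"]] f s
      by (simp add: rep_diff)
    moreover have "(\<lambda>n. C * (1 / real (Suc n))) \<longlonglongrightarrow> 0"
      using tendsto_mult_right_zero[OF LIMSEQ_inverse_real_of_nat, of C] by (simp add: inverse_eq_divide)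
    ultimately have "(\<lambda>n. \<rho> (s (Suc n) (N (Suc n))) - \<rho> f) \<longlonglongrightarrow> 0"
      by (rule Lim_null_comparison[OF always_eventually, OF allI])
    then have lim: "(\<lambda>n. \<rho> (s (Suc n) (N (Suc n))) x) \<longlonglongrightarrow> \<rho> f x"
      by (intro blinfun.tendsto tendsto_const) (rule LIM_zero_cancel)
    have "\<rho> (s (Suc n) (N (Suc n))) x \<in> {y. 0 \<le> y}" for n
      using s[of "Suc n" "N (Suc n)"] \<open>x \<ge> 0\<close> by (simp add: positive_map_def)
    then have "\<rho> f x \<in> {y. 0 \<le> y}"
      by (rule closed_sequentially[OF closed_positive_cone _ lim])
    then show "0 \<le> \<rho> f x" by simp
  qed
qed

lemma topspace_borel: "topspace X \<in> sets (borel_of X)"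
  by (simp add: openin_imp_borel)

lemma op_le_rep:
  assumes "f \<in> bounded_borel X" "g \<in> bounded_borel X" "\<And>t. f t \<le> g t"
  shows "op_le (\<rho> f) (\<rho> g)"
  unfolding op_le_def using assms positive_rep[of "\<lambda>t. g t - f t"]
  by (simp add: bounded_borel_diff rep_diff)

lemma rep_dominated:
  assumes f: "f \<in> bounded_borel X"
  shows "op_le (\<rho> f) (sup_norm f *\<^sub>R P (topspace X))" "op_le (- \<rho> f) (sup_norm f *\<^sub>R P (topspace X))"
proof -
  have ind: "indicator (topspace X) \<in> bounded_borel X"
    by (intro indicator_bounded_borel topspace_borel)
  define u where "u t = sup_norm f * indicator (topspace X) t" for t
  have u: "u \<in> bounded_borel X"
    unfolding u_def by (intro bounded_borel_scale ind)
  have \<rho>u: "\<rho> u = sup_norm f *\<^sub>R P (topspace X)"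
    unfolding u_def by (simp add: rep_scale ind rep_indicator topspace_borel)
  \<comment> \<open>Off \<open>topspace X\<close> both sides are zero.\<close>
  have "\<bar>f t\<bar> \<le> u t" for t
    using f abs_le_sup_norm[OF f, of t] by (cases "t \<in> topspace X") (auto simp: u_def bounded_borel_def)
  then have le: "f t \<le> u t" "-1 * f t \<le> u t" for t
    by (simp_all add: abs_le_iff)
  show "op_le (\<rho> f) (sup_norm f *\<^sub>R P (topspace X))"
    using op_le_rep[OF f u le(1)] by (simp add: \<rho>u)
  show "op_le (- \<rho> f) (sup_norm f *\<^sub>R P (topspace X))"
    using op_le_rep[OF bounded_borel_scale[OF f, of "-1"] u le(2)] rep_scale[OF f, of "-1"]
    by (simp add: \<rho>u)
qed

lemma rep_regular: "f \<in> bounded_borel X \<Longrightarrow> \<rho> f \<in> regular_operators"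
  using rep_dominated by (rule regular_operatorsI_dominated)

lemma norm_rep_le:
  assumes "f \<in> bounded_borel X"
  shows "norm (\<rho> f) \<le> norm (P (topspace X)) * sup_norm f"
  using norm_le_if_dominates[OF rep_dominated[OF assms]] sup_norm_nonneg[OF assms]
  by (simp add: mult.commute)

lemma regular_norm_rep_le:
  assumes "dedekind_complete TYPE('e)" "f \<in> bounded_borel X"
  shows "regular_norm (\<rho> f) \<le> norm (P (topspace X)) * sup_norm f"
  using regular_norm_le[OF assms(1) rep_dominated[OF assms(2)]] sup_norm_nonneg[OF assms(2)]
  by (simp add: mult.commute)

lemma norm_rep_le_regular_norm:
  "dedekind_complete TYPE('e) \<Longrightarrow> f \<in> bounded_borel X \<Longrightarrow> norm (\<rho> f) \<le> regular_norm (\<rho> f)"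
  using norm_le_regular_norm rep_dominated by blast

section \<open>Norms of the generated map and of its restriction\<close>

lemma map_norm_le:
  assumes A: "A \<subseteq> bounded_borel X" "(\<lambda>t. 0) \<in> A"
    and N: "\<And>f. f \<in> bounded_borel X \<Longrightarrow> N (\<rho> f) \<le> norm (P (topspace X)) * sup_norm f"
  shows "map_norm A N \<rho> \<le> norm (P (topspace X))"
  unfolding map_norm_def
proof (rule cSUP_least)
  have "sup_norm (\<lambda>t::'x. 0) \<le> 1"
    by (rule sup_norm_le) simp
  then show "{f \<in> A. sup_norm f \<le> 1} \<noteq> {}"
    using A(2) by auto
next
  fix f
  assume "f \<in> {f \<in> A. sup_norm f \<le> 1}"
  then have "f \<in> bounded_borel X" "sup_norm f \<le> 1"
    using A(1) by auto
  with N[of f] mult_left_mono[of "sup_norm f" 1 "norm (P (topspace X))"]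
  show "N (\<rho> f) \<le> norm (P (topspace X))" by simp
qed

text \<open>The bound on \<open>N\<close> makes the set of values bounded above, without which a
  real supremum need not dominate its members. An abstract \<open>N\<close> covers the operator norm
  and the regular norm alike.\<close>

lemma le_map_norm:
  assumes A: "A \<subseteq> bounded_borel X"
    and N: "\<And>f. f \<in> bounded_borel X \<Longrightarrow> N (\<rho> f) \<le> norm (P (topspace X)) * sup_norm f"
    and f: "f \<in> A" "sup_norm f \<le> 1"
  shows "N (\<rho> f) \<le> map_norm A N \<rho>"
  unfolding map_norm_def
proof (rule cSUP_upper)
  have "N (\<rho> f) \<le> norm (P (topspace X))" if "f \<in> {f \<in> A. sup_norm f \<le> 1}" for f
  proof -
    have "f \<in> bounded_borel X" "sup_norm f \<le> 1"
      using that A by auto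
    with N[of f] mult_left_mono[of "sup_norm f" 1 "norm (P (topspace X))"] show ?thesis
      by simp
  qed
  then show "bdd_above ((\<lambda>f. N (\<rho> f)) ` {f \<in> A. sup_norm f \<le> 1})"
    by (intro bdd_aboveI2)
qed (use f in auto)

lemma map_norm_bounded_borel:
  assumes le: "\<And>f. f \<in> bounded_borel X \<Longrightarrow> N (\<rho> f) \<le> norm (P (topspace X)) * sup_norm f"
    and ge: "\<And>f. f \<in> bounded_borel X \<Longrightarrow> norm (\<rho> f) \<le> N (\<rho> f)"
  shows "map_norm (bounded_borel X) N \<rho> = norm (P (topspace X))"
proof (rule antisym)
  show "map_norm (bounded_borel X) N \<rho> \<le> norm (P (topspace X))"
    using le by (intro map_norm_le) (auto simp: bounded_borel_def)
  have ind: "indicator (topspace X) \<in> bounded_borel X"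
    by (intro indicator_bounded_borel topspace_borel)
  \<comment> \<open>Only an inequality is claimed, since the indicator is zero if the space is
    empty.\<close>
  have "sup_norm (indicator (topspace X)) \<le> 1"
    by (rule sup_norm_le) (simp add: indicator_def)
  then have "N (\<rho> (indicator (topspace X))) \<le> map_norm (bounded_borel X) N \<rho>"
    using le ind by (intro le_map_norm) auto
  with ge[OF ind] show "norm (P (topspace X)) \<le> map_norm (bounded_borel X) N \<rho>"
    by (simp add: rep_indicator topspace_borel)
qed

lemma zero_in_C0: "(\<lambda>t. 0) \<in> C0 X"
  by (auto simp: C0_def intro: exI[of _ "{}"])

text \<open>If a functional \<open>\<phi>\<close> is positive and \<open>f = 1\<close> on a compact set \<open>K\<close>, then
  \<open>\<phi> (P(X) x - \<rho> f x) \<le> \<phi> (P (X - K) x)\<close>; norming \<open>P(X) x\<close> by a positive functional thus makes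
  integration against the signed measure unnecessary, and only its positive part must be small off
  \<open>K\<close>.\<close>

lemma norm_P_le_map_norm_C0:
  assumes X: "Hausdorff_space X" "locally_compact_space X"
    and reg: "regular_spectral_measure X P"
    and le: "\<And>f. f \<in> bounded_borel X \<Longrightarrow> N (\<rho> f) \<le> norm (P (topspace X)) * sup_norm f"
    and ge: "\<And>f. f \<in> bounded_borel X \<Longrightarrow> norm (\<rho> f) \<le> N (\<rho> f)"
  shows "norm (P (topspace X)) \<le> map_norm (C0 X) N \<rho>"
proof (rule norm_blinfun_bound)
  have N_le: "norm (\<rho> f) \<le> map_norm (C0 X) N \<rho>" if f: "f \<in> C0 X" "sup_norm f \<le> 1" for f
  proof -
    have "norm (\<rho> f) \<le> N (\<rho> f)"
      using f(1) C0_subset_bounded_borel by (intro ge) blast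
    also have "\<dots> \<le> map_norm (C0 X) N \<rho>"
      by (rule le_map_norm[where N = N, OF C0_subset_bounded_borel le f])
    finally show ?thesis .
  qed
  have "sup_norm (\<lambda>t::'x. 0) \<le> 1"
    by (rule sup_norm_le) simp
  then show "0 \<le> map_norm (C0 X) N \<rho>"
    using N_le[OF zero_in_C0] norm_ge_zero order_trans by blast
  fix y :: 'e
  \<comment> \<open>Replacing \<open>y\<close> by its modulus preserves the norm and does not
    decrease the norm of the image under \<open>P(X)\<close>, which becomes a positive
    vector.\<close>
  define x where "x = \<bar>y\<bar>"
  have x: "x \<ge> 0" "norm x = norm y"
    by (simp_all add: x_def norm_abs_eq)
  have PX: "positive_map (blinfun_apply (P (topspace X)))"
    by (intro positive topspace_borel)
  then have "op_le (P (topspace X)) (P (topspace X))" "op_le (- P (topspace X)) (P (topspace X))"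
    by (simp_all add: op_le_uminus_positive) (simp add: op_le_iff)
  then have y: "norm (P (topspace X) y) \<le> norm (P (topspace X) x)"
    unfolding x_def by (rule norm_apply_le_norm_apply_abs)
  have "P (topspace X) x \<ge> 0"
    using PX x by (simp add: positive_map_def)
  then obtain \<phi> :: "'e \<Rightarrow>\<^sub>L real" where \<phi>: "\<And>y. y \<ge> 0 \<Longrightarrow> \<phi> y \<ge> 0" "\<And>y. \<bar>\<phi> y\<bar> \<le> norm y"
      "\<phi> (P (topspace X) x) = norm (P (topspace X) x)"
    using positive_norming_functional by blast
  obtain M1 M2 where M1: "finite_measure M1" "regular_borel_measure X M1"
    and \<phi>P: "\<And>D. D \<in> sets (borel_of X) \<Longrightarrow> \<phi> (P D x) = measure M1 D - measure M2 D"
    using reg[unfolded regular_spectral_measure_def, THEN spec[of _ x], THEN spec[of _ \<phi>]] by blast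
  interpret M1: finite_measure M1 by (rule M1)
  have sets_M1: "sets M1 = sets (borel_of X)"
    using M1(2) by (simp add: regular_borel_measure_def)
  have "norm (P (topspace X) x) \<le> map_norm (C0 X) N \<rho> * norm x + e" if "e > 0" for e
  proof -
    have inner: "emeasure M1 (topspace X) = (SUP K\<in>{K. compactin X K \<and> K \<subseteq> topspace X}. emeasure M1 K)"
      using M1(2) openin_topspace[of X] unfolding regular_borel_measure_def by blast
    have "\<exists>K. compactin X K \<and> measure M1 (topspace X) < measure M1 K + e"
    \<comment> \<open>If the total mass is below \<open>e\<close>, the empty set suffices. Otherwise
      the mass minus \<open>e\<close> is nonnegative, so \<open>ennreal\<close> does not truncate
      it.\<close>
    proof (cases "measure M1 (topspace X) < e")
      case True
      then show ?thesis by (intro exI[of _ "{}"]) simp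
    next
      case False
      with \<open>e > 0\<close> have "ennreal (measure M1 (topspace X) - e) < emeasure M1 (topspace X)"
        by (simp add: M1.emeasure_eq_measure ennreal_less_iff)
      then obtain K where "compactin X K" "ennreal (measure M1 (topspace X) - e) < emeasure M1 K"
        unfolding inner less_SUP_iff by blast
      with False show ?thesis
        by (intro exI[of _ K]) (simp add: M1.emeasure_eq_measure ennreal_less_iff)
    qed
    then obtain K where K: "compactin X K" "measure M1 (topspace X) < measure M1 K + e"
      by blast
    have K_sets: "K \<in> sets (borel_of X)"
      by (rule compactin_imp_borel[OF X(1) K(1)])
    obtain f where f: "f \<in> C0 X" "\<And>t. 0 \<le> f t" "\<And>t. f t \<le> 1" "\<And>t. t \<in> K \<Longrightarrow> f t = 1"
      using C0_Urysohn[OF X K(1)] by blast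
    have fB: "f \<in> bounded_borel X"
      using f(1) C0_subset_bounded_borel by blast
    have rest: "topspace X - K \<in> sets (borel_of X)"
      using topspace_borel K_sets by (rule sets.Diff)
    \<comment> \<open>Pointwise comparison: \<open>f\<close> equals 1 on \<open>K\<close>, and off
      \<open>K\<close> the indicator supplies 1 while \<open>f\<close> is nonnegative.\<close>
    have "op_le (\<rho> (indicator (topspace X))) (\<rho> (\<lambda>t. f t + indicator (topspace X - K) t))"
      using f fB rest topspace_borel
      by (intro op_le_rep bounded_borel_add indicator_bounded_borel) (auto simp: indicator_def)
    then have "P (topspace X) x \<le> \<rho> f x + P (topspace X - K) x"
      using x fB rest
      by (simp add: op_le_iff rep_add rep_indicator indicator_bounded_borel topspace_borel blinfun.add_left)
    then have "\<phi> (P (topspace X) x) \<le> \<phi> (\<rho> f x) + \<phi> (P (topspace X - K) x)"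
      using \<phi>(1)[of "\<rho> f x + P (topspace X - K) x - P (topspace X) x"]
      by (simp add: blinfun.add_right blinfun.diff_right)
    moreover have "\<phi> (P (topspace X - K) x) \<le> e"
    proof -
      have "measure M1 (topspace X - K) = measure M1 (topspace X) - measure M1 K"
        using K_sets topspace_borel compactin_subset_topspace[OF K(1)]
        by (intro M1.finite_measure_Diff) (auto simp: sets_M1)
      with K(2) show ?thesis
        using \<phi>P[OF rest] measure_nonneg[of M2 "topspace X - K"] by linarith
    qed
    moreover have "\<phi> (\<rho> f x) \<le> map_norm (C0 X) N \<rho> * norm x"
    proof -
      have "sup_norm f \<le> 1"
        using f by (intro sup_norm_le) simp
      then have "norm (\<rho> f) * norm x \<le> map_norm (C0 X) N \<rho> * norm x"
        by (intro mult_right_mono N_le f) auto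
      with \<phi>(2)[of "\<rho> f x"] norm_blinfun[of "\<rho> f" x] show ?thesis by simp
    qed
    ultimately show ?thesis
      using \<phi>(3) by simp
  qed
  then have "norm (P (topspace X) x) \<le> map_norm (C0 X) N \<rho> * norm x"
    by (rule field_le_epsilon)
  with x y show "norm (P (topspace X) y) \<le> map_norm (C0 X) N \<rho> * norm y" by simp
qed

lemma map_norm_C0:
  assumes X: "Hausdorff_space X" "locally_compact_space X"
    and reg: "regular_spectral_measure X P"
    and le: "\<And>f. f \<in> bounded_borel X \<Longrightarrow> N (\<rho> f) \<le> norm (P (topspace X)) * sup_norm f"
    and ge: "\<And>f. f \<in> bounded_borel X \<Longrightarrow> norm (\<rho> f) \<le> N (\<rho> f)"
  shows "map_norm (C0 X) N \<rho> = norm (P (topspace X))"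
  using norm_P_le_map_norm_C0[OF assms] map_norm_le[where N = N, OF C0_subset_bounded_borel zero_in_C0 le]
  by (intro antisym) auto

end

theorem proposition5p10:
  fixes X :: "'x topology"
    and \<pi> \<pi>P :: "('x \<Rightarrow> real) \<Rightarrow> ('e::banach_lattice \<Rightarrow>\<^sub>L 'e)"
    and P :: "'x set \<Rightarrow> ('e \<Rightarrow>\<^sub>L 'e)"
  assumes "Hausdorff_space X" and "locally_compact_space X"
    and "positive_representation (C0 X) \<pi>"
    and "\<forall>f\<in>C0 X. \<pi> f \<in> regular_operators"
    and "positive_spectral_measure X P"
    and "generated_representation X P \<pi>P"
    and "\<forall>f\<in>C0 X. \<pi> f = \<pi>P f"
  shows "(bounded_into (C0 X) regular_operators norm \<pi> \<and>
          map_norm (C0 X) norm \<pi> \<le> map_norm (bounded_borel X) norm \<pi>P \<and>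
          map_norm (bounded_borel X) norm \<pi>P = norm (P (topspace X)))
       \<and> (regular_spectral_measure X P \<longrightarrow>
          map_norm (C0 X) norm \<pi> = map_norm (bounded_borel X) norm \<pi>P \<and>
          map_norm (bounded_borel X) norm \<pi>P = norm (P (topspace X)))
       \<and> (regular_spectral_measure X P \<and> dedekind_complete TYPE('e) \<longrightarrow>
          bounded_into (C0 X) regular_operators norm \<pi> \<and>
          bounded_into (C0 X) regular_operators regular_norm \<pi> \<and>
          bounded_into (bounded_borel X) regular_operators norm \<pi>P \<and>
          bounded_into (bounded_borel X) regular_operators regular_norm \<pi>P \<and>
          map_norm (C0 X) norm \<pi> = map_norm (C0 X) regular_norm \<pi> \<and>
          map_norm (C0 X) regular_norm \<pi> = map_norm (bounded_borel X) norm \<pi>P \<and>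
          map_norm (bounded_borel X) norm \<pi>P = map_norm (bounded_borel X) regular_norm \<pi>P \<and>
          map_norm (bounded_borel X) regular_norm \<pi>P = norm (P (topspace X)))"
proof -
  interpret positive_generated_representation X P \<pi>P
    using assms(5,6)
    by unfold_locales (auto simp: positive_spectral_measure_def)
  have C0: "f \<in> bounded_borel X" if "f \<in> C0 X" for f
    using that C0_subset_bounded_borel by blast
  \<comment> \<open>\<open>\<pi>\<close> and \<open>\<pi>P\<close> agree on \<open>C0 X\<close>, so
    the estimates for the restriction of \<open>\<pi>P\<close> carry over.\<close>
  have map_norm_\<pi>: "map_norm (C0 X) N \<pi> = map_norm (C0 X) N \<pi>P" for N
    unfolding map_norm_def using assms(7) by (intro SUP_cong) auto
  have bounded_\<pi>P: "bounded_into (bounded_borel X) regular_operators N \<pi>P"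
    and bounded_\<pi>: "bounded_into (C0 X) regular_operators N \<pi>"
    if "\<And>f. f \<in> bounded_borel X \<Longrightarrow> N (\<pi>P f) \<le> norm (P (topspace X)) * sup_norm f" for N
    using that rep_regular C0 assms(7) by (auto simp: bounded_into_def)
  have 1: "map_norm (bounded_borel X) norm \<pi>P = norm (P (topspace X))"
    by (intro map_norm_bounded_borel norm_rep_le) auto
  have "map_norm (C0 X) norm \<pi> \<le> norm (P (topspace X))"
    unfolding map_norm_\<pi> by (intro map_norm_le C0_subset_bounded_borel zero_in_C0 norm_rep_le)
  moreover have 2: "map_norm (C0 X) norm \<pi> = norm (P (topspace X))" if "regular_spectral_measure X P"
    unfolding map_norm_\<pi> using assms(1,2) that by (intro map_norm_C0 norm_rep_le) auto
  moreover have 3: "map_norm (C0 X) regular_norm \<pi> = norm (P (topspace X))"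
    if "regular_spectral_measure X P" "dedekind_complete TYPE('e)"
    unfolding map_norm_\<pi> using assms(1,2) that
    by (intro map_norm_C0 regular_norm_rep_le norm_rep_le_regular_norm)
  moreover have 4: "map_norm (bounded_borel X) regular_norm \<pi>P = norm (P (topspace X))"
    if "dedekind_complete TYPE('e)"
    using that by (intro map_norm_bounded_borel regular_norm_rep_le norm_rep_le_regular_norm)
  ultimately show ?thesis
    using 1 bounded_\<pi>[of norm] bounded_\<pi>[of regular_norm] bounded_\<pi>P[of norm]
      bounded_\<pi>P[of regular_norm] norm_rep_le regular_norm_rep_le
    by simp
qed

end
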